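(* For all integers $i\geq 1$ and $n\geq 0$, $$\overline{OPT}_{3^i}(3n+2)\equiv 0\pmod{3^{i+1}}.$$
   Context: For a positive integer $m$ let $f_m:=(q^m;q^m)_\infty=\prod_{i\ge 1}(1-q^{mi})$ (as a formal power series in $q$). For a positive integer $k$ and integers $n\ge 0$, $\overline{OPT}_k(n)$ denotes the number of overpartition $k$-tuples of $n$ with all parts odd: $k$-tuples $(\xi_1,\dots,\xi_k)$ of overpartitions (partitions in which the first occurrence of each part size may be overlined) with all parts odd and total sum of all parts equal to $n$. Its generating function is $$\sum_{n\geq 0}\overline{OPT}_k(n)q^n=\frac{f_{2}^{3k}}{f_{1}^{2k}f_{4}^{k}}.$$ *)

theory Defs
  imports "HOL-Library.Multiset" "HOL-Number_Theory.Cong"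
begin

text \<open>
  An overpartition is encoded as a pair \<open>(M, S)\<close>: \<open>M\<close> is the multiset of parts and \<open>S\<close> is the set
  of those part sizes whose first occurrence is overlined. Since at most one copy of each size can
  be overlined, and its position among the equal parts is prescribed, \<open>S\<close> determines the overlining.
\<close>

definition overpartition :: "nat multiset \<times> nat set \<Rightarrow> bool" where
  "overpartition \<xi> \<longleftrightarrow> (\<forall>p \<in># fst \<xi>. 0 < p) \<and> snd \<xi> \<subseteq> set_mset (fst \<xi>)"

definition all_parts_odd :: "nat multiset \<times> nat set \<Rightarrow> bool" where
  "all_parts_odd \<xi> \<longleftrightarrow> (\<forall>p \<in># fst \<xi>. odd p)"

definition odd_overpartition_tuples :: "nat \<Rightarrow> nat \<Rightarrow> (nat multiset \<times> nat set) list set" where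
  "odd_overpartition_tuples k n =
     {\<xi>s. length \<xi>s = k \<and> (\<forall>\<xi> \<in> set \<xi>s. overpartition \<xi> \<and> all_parts_odd \<xi>) \<and>
          (\<Sum>\<xi>\<leftarrow>\<xi>s. sum_mset (fst \<xi>)) = n}"

definition OPT :: "nat \<Rightarrow> nat \<Rightarrow> nat" where
  "OPT k n = card (odd_overpartition_tuples k n)"

text \<open>The tuples counted form a finite set, so \<^const>\<open>card\<close> is the intended count.\<close>

lemma finite_odd_overpartition_tuples: "finite (odd_overpartition_tuples k n)"
proof -
  define A where "A = {M :: nat multiset. set_mset M \<subseteq> {..n} \<and> size M \<le> n}"
  have "A \<subseteq> mset ` {xs. set xs \<subseteq> {..n} \<and> length xs \<le> n}"
  proof
    fix M assume M: "M \<in> A"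
    obtain xs where "mset xs = M" using ex_mset by blast
    with M show "M \<in> mset ` {xs. set xs \<subseteq> {..n} \<and> length xs \<le> n}"
      unfolding A_def by auto
  qed
  then have "finite A"
    by (rule finite_subset) (intro finite_imageI finite_lists_length_le, simp)
  then have fin: "finite {\<xi>s. set \<xi>s \<subseteq> A \<times> Pow {..n} \<and> length \<xi>s = k}"
    by (intro finite_lists_length_eq) simp
  have size_le: "size M \<le> sum_mset M" if "\<forall>p \<in># M. 0 < p" for M :: "nat multiset"
    using that by (induction M) auto
  have "set \<xi>s \<subseteq> A \<times> Pow {..n}" if "\<xi>s \<in> odd_overpartition_tuples k n" for \<xi>s
  proof
    fix \<xi> assume mem: "\<xi> \<in> set \<xi>s"
    obtain M S where \<xi>: "\<xi> = (M, S)" by fastforce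
    have "overpartition \<xi>"
      using that mem by (simp add: odd_overpartition_tuples_def)
    then have over: "\<forall>p \<in># M. 0 < p" "S \<subseteq> set_mset M"
      using \<xi> by (auto simp: overpartition_def)
    have "sum_mset (fst \<xi>) \<le> (\<Sum>\<xi>\<leftarrow>\<xi>s. sum_mset (fst \<xi>))"
      using mem by (intro member_le_sum_list) auto
    with that \<xi> have le: "sum_mset M \<le> n" by (simp add: odd_overpartition_tuples_def)
    have "set_mset M \<subseteq> {..n}"
    proof
      fix p assume "p \<in># M"
      then have "M = add_mset p (M - {#p#})" by simp
      then have "sum_mset M = p + sum_mset (M - {#p#})" by (metis sum_mset.add_mset)
      with le show "p \<in> {..n}" by simp
    qed
    with over le size_le[OF over(1)] \<xi> show "\<xi> \<in> A \<times> Pow {..n}" by (auto simp: A_def)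
  qed
  then show ?thesis
    by (intro finite_subset[OF _ fin]) (auto simp: odd_overpartition_tuples_def)
qed

end

theory Submission
  imports Defs "HOL-Computational_Algebra.Formal_Power_Series"
begin

unbundle fps_syntax

text \<open>
  Write \<open>A\<close> for the generating function of overpartitions into odd parts. Logarithmic
  differentiation gives \<open>X * A' = 2 * S * A\<close> with \<open>S = (\<Sum>m odd. \<sigma>(m) * X ^ m)\<close>, hence
  \<open>n * c n = 2 * k * (\<Sum>m odd. \<sigma>(m) * c (n - m))\<close> for the coefficients \<open>c\<close> of \<open>A ^ k\<close>.
  Let \<open>k = 3 ^ i\<close> with \<open>i \<ge> 1\<close>. The recurrence shows that \<open>3\<close> divides \<open>c n\<close> unless it divides
  \<open>n\<close>. If \<open>n \<equiv> 2 (mod 3)\<close>, then every summand is divisible by \<open>3\<close>: either \<open>n - m\<close> is not a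
  multiple of \<open>3\<close>, or \<open>m \<equiv> 2 (mod 3)\<close>, and then \<open>3\<close> divides \<open>\<sigma>(m)\<close> because \<open>d * e \<equiv> 2\<close> forces
  \<open>d + e \<equiv> 0\<close>. So \<open>3 ^ (i + 1)\<close> divides \<open>n * c n\<close>, and \<open>n\<close> is coprime to \<open>3\<close>.
\<close>

section \<open>Single overpartitions into odd parts, and tuples as powers of a power series\<close>

definition odd_overpartitions :: "nat \<Rightarrow> (nat multiset \<times> nat set) set" where
  "odd_overpartitions n = {\<xi>. overpartition \<xi> \<and> all_parts_odd \<xi> \<and> sum_mset (fst \<xi>) = n}"

lemma odd_overpartitions_iff:
  "(M, S) \<in> odd_overpartitions n \<longleftrightarrow>
     (\<forall>p\<in>#M. odd p) \<and> S \<subseteq> set_mset M \<and> sum_mset M = n"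
  by (auto simp: odd_overpartitions_def overpartition_def all_parts_odd_def odd_pos)

lemma finite_odd_overpartitions: "finite (odd_overpartitions n)"
proof (rule finite_subset)
  show "odd_overpartitions n \<subseteq> hd ` odd_overpartition_tuples 1 n"
  proof
    fix \<xi> assume "\<xi> \<in> odd_overpartitions n"
    then have "[\<xi>] \<in> odd_overpartition_tuples 1 n"
      by (simp add: odd_overpartitions_def odd_overpartition_tuples_def)
    then show "\<xi> \<in> hd ` odd_overpartition_tuples 1 n"
      by (intro image_eqI[where x = "[\<xi>]"]) simp_all
  qed
qed (intro finite_imageI finite_odd_overpartition_tuples)

lemma OPT_0: "OPT 0 n = (if n = 0 then 1 else 0)"
proof -
  have "odd_overpartition_tuples 0 n = (if n = 0 then {[]} else {})"
    by (auto simp: odd_overpartition_tuples_def)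
  then show ?thesis by (simp add: OPT_def)
qed

text \<open>Splitting off the head of a tuple, sorted by its sum \<open>m\<close>, gives the
  convolution behind \<open>OPT_eq_fps_nth\<close>.\<close>

lemma OPT_Suc: "OPT (Suc k) n = (\<Sum>m\<le>n. card (odd_overpartitions m) * OPT k (n - m))"
proof -
  let ?T = "\<lambda>m. odd_overpartitions m \<times> odd_overpartition_tuples k (n - m)"
  have "bij_betw (\<lambda>(\<xi>, \<xi>s). \<xi> # \<xi>s) (\<Union>m\<le>n. ?T m) (odd_overpartition_tuples (Suc k) n)"
  proof (rule bij_betw_imageI)
    show "inj_on (\<lambda>(\<xi>, \<xi>s). \<xi> # \<xi>s) (\<Union>m\<le>n. ?T m)"
      by (auto simp: inj_on_def)
    show "(\<lambda>(\<xi>, \<xi>s). \<xi> # \<xi>s) ` (\<Union>m\<le>n. ?T m) = odd_overpartition_tuples (Suc k) n"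
    proof (intro equalityI subsetI)
      fix zs assume zs: "zs \<in> odd_overpartition_tuples (Suc k) n"
      then obtain \<xi> \<xi>s where "zs = \<xi> # \<xi>s"
        by (cases zs) (auto simp: odd_overpartition_tuples_def)
      with zs show "zs \<in> (\<lambda>(\<xi>, \<xi>s). \<xi> # \<xi>s) ` (\<Union>m\<le>n. ?T m)"
        by (intro image_eqI[where x = "(\<xi>, \<xi>s)"] UN_I[where a = "sum_mset (fst \<xi>)"])
          (auto simp: odd_overpartition_tuples_def odd_overpartitions_def)
    qed (auto simp: odd_overpartition_tuples_def odd_overpartitions_def)
  qed
  then have "OPT (Suc k) n = card (\<Union>m\<le>n. ?T m)"
    by (simp add: OPT_def bij_betw_same_card)
  also have "\<dots> = (\<Sum>m\<le>n. card (?T m))"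
    by (rule card_UN_disjoint)
      (simp_all add: finite_odd_overpartitions finite_odd_overpartition_tuples,
        auto simp: odd_overpartitions_def)
  finally show ?thesis by (simp add: card_cartesian_product OPT_def)
qed

definition odd_overpartition_fps :: "int fps" where
  "odd_overpartition_fps = Abs_fps (\<lambda>n. int (card (odd_overpartitions n)))"

lemma odd_overpartition_fps_nth [simp]:
  "odd_overpartition_fps $ n = int (card (odd_overpartitions n))"
  by (simp add: odd_overpartition_fps_def)

lemma OPT_eq_fps_nth: "int (OPT k n) = (odd_overpartition_fps ^ k) $ n"
proof (induction k arbitrary: n)
  case (Suc k)
  then show ?case by (simp add: OPT_Suc fps_mult_nth atMost_atLeast0)
qed (simp add: OPT_0)

section \<open>Inserting and removing a part of fixed size\<close>

text \<open>The size \<open>p\<close> may still occur, only without an overline. For odd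
  \<open>p\<close> the generating function is \<open>A / (1 + X ^ p)\<close>.\<close>

definition unmarked :: "nat \<Rightarrow> nat \<Rightarrow> (nat multiset \<times> nat set) set" where
  "unmarked p n = {\<xi> \<in> odd_overpartitions n. p \<notin> snd \<xi>}"

lemma finite_unmarked: "finite (unmarked p n)"
  by (simp add: unmarked_def finite_odd_overpartitions)

text \<open>The inverse removes one copy of \<open>p\<close>. As \<open>p\<close> is not in
  \<open>S\<close>, the overlined sizes all survive, even if that copy was the last one.\<close>

lemma bij_betw_add_part:
  assumes "odd p"
  shows "bij_betw (\<lambda>(M, S). (add_mset p M, S)) (unmarked p n)
           {\<xi> \<in> unmarked p (n + p). p \<in># fst \<xi>}"
proof (rule bij_betw_byWitness[where f' = "\<lambda>(M, S). (M - {#p#}, S)"])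
  show "(\<lambda>(M, S). (M - {#p#}, S)) ` {\<xi> \<in> unmarked p (n + p). p \<in># fst \<xi>} \<subseteq> unmarked p n"
  proof clarify
    fix M S assume *: "(M, S) \<in> unmarked p (n + p)" "p \<in># fst (M, S)"
    then obtain N where "M = add_mset p N" by (auto dest: multi_member_split)
    with * show "(M - {#p#}, S) \<in> unmarked p n"
      by (auto simp: unmarked_def odd_overpartitions_iff)
  qed
qed (use assms in \<open>auto simp: unmarked_def odd_overpartitions_iff subset_iff\<close>)

text \<open>The inverse removes the overlined copy of \<open>p\<close>; any further copies stay
  behind, no longer marked.\<close>

lemma bij_betw_add_marked_part:
  assumes "odd p"
  shows "bij_betw (\<lambda>(M, S). (add_mset p M, insert p S)) (unmarked p n)
           {\<xi> \<in> odd_overpartitions (n + p). p \<in> snd \<xi>}"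
proof (rule bij_betw_byWitness[where f' = "\<lambda>(M, S). (M - {#p#}, S - {p})"])
  show "(\<lambda>(M, S). (M - {#p#}, S - {p})) ` {\<xi> \<in> odd_overpartitions (n + p). p \<in> snd \<xi>}
          \<subseteq> unmarked p n"
  proof clarify
    fix M S assume *: "(M, S) \<in> odd_overpartitions (n + p)" "p \<in> snd (M, S)"
    then have "p \<in># M" by (auto simp: odd_overpartitions_iff)
    then obtain N where "M = add_mset p N" by (blast dest: multi_member_split)
    with * show "(M - {#p#}, S - {p}) \<in> unmarked p n"
      by (auto simp: unmarked_def odd_overpartitions_iff)
  qed
qed (use assms in \<open>auto simp: unmarked_def odd_overpartitions_iff subset_iff\<close>)

definition unmarked_count :: "nat \<Rightarrow> nat \<Rightarrow> nat" where
  "unmarked_count p n = (\<Sum>\<xi>\<in>unmarked p n. count (fst \<xi>) p)"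

lemma part_le:
  assumes "\<xi> \<in> odd_overpartitions n" "p \<in># fst \<xi>"
  shows "p \<le> n"
  using assms by (auto simp: odd_overpartitions_def dest!: multi_member_split)

lemma marked_part_le:
  assumes "\<xi> \<in> odd_overpartitions n" "p \<in> snd \<xi>"
  shows "p \<le> n"
  using assms part_le[OF assms(1), of p] by (auto simp: odd_overpartitions_def overpartition_def)

lemma unmarked_count_less: "n < p \<Longrightarrow> unmarked_count p n = 0"
  unfolding unmarked_count_def
  by (rule sum.neutral) (auto simp: unmarked_def count_eq_zero_iff dest: part_le)

text \<open>Objects without \<open>p\<close> contribute nothing; in each of the others, removing one
  copy of \<open>p\<close> lowers the count by one.\<close>

lemma unmarked_count_add:
  assumes "odd p"
  shows "unmarked_count p (n + p) = unmarked_count p n + card (unmarked p n)"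
proof -
  have "unmarked_count p (n + p) = (\<Sum>\<xi>\<in>{\<xi> \<in> unmarked p (n + p). p \<in># fst \<xi>}. count (fst \<xi>) p)"
    unfolding unmarked_count_def
    by (rule sum.mono_neutral_right) (auto simp: finite_unmarked count_eq_zero_iff)
  also have "\<dots> = (\<Sum>\<xi>\<in>unmarked p n. count (fst \<xi>) p + 1)"
    by (subst sum.reindex_bij_betw[OF bij_betw_add_part[OF assms], symmetric])
      (auto intro!: sum.cong simp: split_beta)
  finally show ?thesis by (simp only: sum.distrib) (simp add: unmarked_count_def)
qed

lemma odd_overpartitions_split:
  "odd_overpartitions n = unmarked p n \<union> {\<xi> \<in> odd_overpartitions n. p \<in> snd \<xi>}"
  by (auto simp: unmarked_def)

lemma card_odd_overpartitions_less:
  assumes "n < p"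
  shows "card (odd_overpartitions n) = card (unmarked p n)"
  using assms by (intro arg_cong[where f = card]) (auto simp: unmarked_def dest: marked_part_le)

text \<open>Distinguish whether \<open>p\<close> is overlined: this is
  \<open>A = (1 + X ^ p) * (A / (1 + X ^ p))\<close> in coefficients.\<close>

lemma card_odd_overpartitions_add:
  assumes "odd p"
  shows "card (odd_overpartitions (n + p)) = card (unmarked p (n + p)) + card (unmarked p n)"
proof -
  have "card (odd_overpartitions (n + p)) =
      card (unmarked p (n + p)) + card {\<xi> \<in> odd_overpartitions (n + p). p \<in> snd \<xi>}"
    by (subst odd_overpartitions_split[of _ p], rule card_Un_disjoint)
      (auto simp: finite_odd_overpartitions unmarked_def)
  then show ?thesis
    using bij_betw_same_card[OF bij_betw_add_marked_part[OF assms]] by simp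
qed

text \<open>Overlined and non-overlined occurrences contribute equally, since both totals come from
  adding one copy of \<open>p\<close> to the members of \<open>unmarked p (n - p)\<close>. This is
  the source of the factor 2 in the recurrence.\<close>

lemma sum_count_eq:
  assumes "odd p"
  shows "(\<Sum>\<xi>\<in>odd_overpartitions n. count (fst \<xi>) p) = 2 * unmarked_count p n"
proof -
  let ?V = "\<lambda>n. {\<xi> \<in> odd_overpartitions n. p \<in> snd \<xi>}"
  have "(\<Sum>\<xi>\<in>odd_overpartitions n. count (fst \<xi>) p) =
      unmarked_count p n + (\<Sum>\<xi>\<in>?V n. count (fst \<xi>) p)"
    unfolding unmarked_count_def
    by (subst odd_overpartitions_split[of _ p], rule sum.union_disjoint)
      (auto simp: finite_odd_overpartitions unmarked_def)
  moreover have "(\<Sum>\<xi>\<in>?V n. count (fst \<xi>) p) = unmarked_count p n"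
  proof (cases "n < p")
    case True
    then have "?V n = {}" by (auto dest: marked_part_le)
    then show ?thesis by (simp only: unmarked_count_less[OF True] sum.empty)
  next
    case False
    then obtain l where n: "n = l + p" by (metis add.commute le_Suc_ex not_less)
    have "(\<Sum>\<xi>\<in>?V (l + p). count (fst \<xi>) p) = (\<Sum>\<xi>\<in>unmarked p l. count (fst \<xi>) p + 1)"
      by (subst sum.reindex_bij_betw[OF bij_betw_add_marked_part[OF assms], symmetric])
        (auto intro!: sum.cong simp: split_beta)
    also have "\<dots> = unmarked_count p (l + p)"
      by (simp only: sum.distrib unmarked_count_add[OF assms]) (simp add: unmarked_count_def)
    finally show ?thesis by (simp only: n)
  qed
  ultimately show ?thesis by simp
qed

text \<open>The generating function is \<open>A * X ^ p / (1 - X ^ (2 * p))\<close>, so only odd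
  multiples of \<open>p\<close> appear. Two uses of \<open>unmarked_count_add\<close> produce
  \<open>card (unmarked p (l + p)) + card (unmarked p l)\<close>, which is a count of all odd
  overpartitions of \<open>l + p\<close>; hence the induction descends by
  \<open>2 * p\<close>.\<close>

lemma unmarked_count_eq:
  assumes "odd p"
  shows "unmarked_count p n =
    (\<Sum>m\<in>{m\<in>{1..n}. odd m \<and> p dvd m}. card (odd_overpartitions (n - m)))"
proof (induction n rule: less_induct)
  case (less n)
  let ?I = "\<lambda>n. {m\<in>{1..n}. odd m \<and> p dvd m}"
  have p: "p > 0" using assms by (rule odd_pos)
  consider "n < p" | "p \<le> n" "n < 2 * p" | "2 * p \<le> n" by linarith
  then show ?case
  proof cases
    case 1
    then have "?I n = {}" by (auto dest!: dvd_imp_le)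
    with 1 show ?thesis by (simp only: unmarked_count_less sum.empty)
  next
    case 2
    have "?I n = {p}"
    proof (intro equalityI subsetI)
      fix m assume m: "m \<in> ?I n"
      then obtain k where k: "m = p * k" by auto
      have "m < p * 2" using m 2 by simp
      then have "k < 2" using k p by simp
      with m k show "m \<in> {p}" by (cases k) auto
    qed (use 2 p assms in auto)
    moreover obtain l where l: "n = l + p" using 2 by (metis add.commute le_Suc_ex)
    moreover have "l < p" using 2 l by simp
    ultimately show ?thesis
      by (simp add: unmarked_count_add[OF assms] unmarked_count_less card_odd_overpartitions_less
        del: atLeastAtMost_iff mem_Collect_eq)
  next
    case 3
    obtain l where l: "n = l + p + p" by (rule that[of "n - 2 * p"]) (use 3 in simp)
    \<comment> \<open>The odd multiples of \<open>p\<close> up to \<open>n\<close> are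
      \<open>p\<close> itself and those up to \<open>l\<close> shifted by
      \<open>2 * p\<close>.\<close>
    have "?I n = insert p ((\<lambda>m. m + 2 * p) ` ?I l)"
    proof (intro equalityI subsetI)
      fix m assume m: "m \<in> ?I n"
      then obtain k where k: "m = p * k" by auto
      with m have "odd k" by simp
      show "m \<in> insert p ((\<lambda>m. m + 2 * p) ` ?I l)"
      proof (cases "k = 1")
        case False
        obtain i where "k = 2 * i + 1" using \<open>odd k\<close> by (rule oddE)
        moreover from this False obtain i' where "i = Suc i'" by (cases i) auto
        ultimately have "k = 2 * i' + 1 + 2" by simp
        then obtain j where j: "k = j + 2" "odd j" by (rule that) simp
        have "p * j \<in> ?I l" using m k j p l assms by (auto simp: algebra_simps odd_pos Suc_le_eq)
        moreover have "m = p * j + 2 * p" using k j by (simp add: algebra_simps)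
        ultimately show ?thesis by blast
      qed (simp add: k)
    qed (use l p assms in auto)
    moreover have "p \<notin> (\<lambda>m. m + 2 * p) ` ?I l" using p by auto
    ultimately have "(\<Sum>m\<in>?I n. card (odd_overpartitions (n - m))) =
        card (odd_overpartitions (l + p)) +
        (\<Sum>m\<in>(\<lambda>m. m + 2 * p) ` ?I l. card (odd_overpartitions (n - m)))"
      by (simp add: l del: mem_Collect_eq)
    also have "(\<Sum>m\<in>(\<lambda>m. m + 2 * p) ` ?I l. card (odd_overpartitions (n - m))) =
        (\<Sum>m\<in>?I l. card (odd_overpartitions (l - m)))"
      by (subst sum.reindex) (auto simp: l inj_on_def intro!: sum.cong)
    also have "\<dots> = unmarked_count p l"
      using p l by (intro less.IH[symmetric]) simp
    finally show ?thesis
      by (simp add: l unmarked_count_add[OF assms] card_odd_overpartitions_add[OF assms])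
  qed
qed

section \<open>The divisor-sum recurrence for single overpartitions\<close>

lemma sum_mset_eq_sum_count:
  fixes M :: "nat multiset"
  assumes "finite A" "set_mset M \<subseteq> A"
  shows "sum_mset M = (\<Sum>p\<in>A. p * count M p)"
  using assms
proof (induction M)
  case (add x M)
  have "(\<Sum>p\<in>A. p * count (add_mset x M) p) = (\<Sum>p\<in>A. p * count M p + (if p = x then x else 0))"
    by (intro sum.cong) auto
  with add show ?case by (simp add: sum.distrib)
qed simp

definition divisor_sum :: "nat \<Rightarrow> nat" where
  "divisor_sum m = \<Sum>{d. d dvd m}"

text \<open>The sum of all parts of all objects is counted twice: object by object it is
  \<open>n\<close> times their number, and by part size \<open>p\<close> it is a sum over odd
  multiples \<open>m\<close> of \<open>p\<close>. Swapping \<open>p\<close> and \<open>m\<close>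
  collects the divisors of \<open>m\<close>.\<close>

lemma card_odd_overpartitions_rec:
  "n * card (odd_overpartitions n) =
     2 * (\<Sum>m\<in>{m\<in>{1..n}. odd m}. divisor_sum m * card (odd_overpartitions (n - m)))"
proof -
  let ?P = "{p\<in>{1..n}. odd p}" and ?a = "\<lambda>m. card (odd_overpartitions m)"
  have "n * ?a n = (\<Sum>\<xi>\<in>odd_overpartitions n. sum_mset (fst \<xi>))"
    by (simp add: odd_overpartitions_def)
  also have "\<dots> = (\<Sum>\<xi>\<in>odd_overpartitions n. \<Sum>p\<in>?P. p * count (fst \<xi>) p)"
  proof (intro sum.cong refl sum_mset_eq_sum_count)
    fix \<xi> assume "\<xi> \<in> odd_overpartitions n"
    then show "set_mset (fst \<xi>) \<subseteq> ?P"
      using part_le[of \<xi> n]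
      by (auto simp: odd_overpartitions_def all_parts_odd_def odd_pos Suc_le_eq)
  qed simp
  also have "\<dots> = (\<Sum>p\<in>?P. p * (\<Sum>\<xi>\<in>odd_overpartitions n. count (fst \<xi>) p))"
    by (subst sum.swap) (simp add: sum_distrib_left)
  also have "\<dots> = (\<Sum>p\<in>?P. p * (2 * (\<Sum>m\<in>{m\<in>?P. p dvd m}. ?a (n - m))))"
  proof (intro sum.cong refl)
    fix p assume "p \<in> ?P"
    then show "p * (\<Sum>\<xi>\<in>odd_overpartitions n. count (fst \<xi>) p) =
        p * (2 * (\<Sum>m\<in>{m\<in>?P. p dvd m}. ?a (n - m)))"
      by (simp add: sum_count_eq unmarked_count_eq conj_assoc)
  qed
  also have "\<dots> = 2 * (\<Sum>p\<in>?P. \<Sum>m\<in>{m\<in>?P. p dvd m}. p * ?a (n - m))"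
    by (simp add: sum_distrib_left mult.left_commute)
  also have "(\<Sum>p\<in>?P. \<Sum>m\<in>{m\<in>?P. p dvd m}. p * ?a (n - m)) =
      (\<Sum>m\<in>?P. \<Sum>p\<in>{p\<in>?P. p dvd m}. p * ?a (n - m))"
    by (rule sum.swap_restrict) simp_all
  also have "\<dots> = (\<Sum>m\<in>?P. divisor_sum m * ?a (n - m))"
  proof (intro sum.cong refl)
    fix m assume "m \<in> ?P"
    \<comment> \<open>Every divisor of the odd number \<open>m\<close> is odd and at most
      \<open>n\<close>, so the restriction to \<open>?P\<close> loses none.\<close>
    then have "{p\<in>?P. p dvd m} = {d. d dvd m}"
      by (auto dest: dvd_imp_le dvd_pos_nat dvd_trans simp: Suc_le_eq)
    then show "(\<Sum>p\<in>{p\<in>?P. p dvd m}. p * ?a (n - m)) = divisor_sum m * ?a (n - m)"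
      by (simp add: divisor_sum_def sum_distrib_right)
  qed
  finally show ?thesis .
qed

section \<open>Logarithmic differentiation and the recurrence for tuples\<close>

definition odd_divisor_sum_fps :: "int fps" where
  "odd_divisor_sum_fps = Abs_fps (\<lambda>m. if odd m then int (divisor_sum m) else 0)"

lemma fps_X_mult_deriv_nth:
  fixes F :: "'a::comm_semiring_1 fps"
  shows "(fps_X * fps_deriv F) $ n = of_nat n * F $ n"
  by (cases n) simp_all

lemma odd_divisor_sum_fps_mult_nth:
  "(odd_divisor_sum_fps * F) $ n = (\<Sum>m\<in>{m\<in>{1..n}. odd m}. int (divisor_sum m) * F $ (n - m))"
proof -
  have "(odd_divisor_sum_fps * F) $ n =
      (\<Sum>m=0..n. if odd m then int (divisor_sum m) * F $ (n - m) else 0)"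
    by (auto simp: fps_mult_nth odd_divisor_sum_fps_def intro!: sum.cong)
  also have "\<dots> = (\<Sum>m\<in>{m\<in>{0..n}. odd m}. int (divisor_sum m) * F $ (n - m))"
    by (rule sum.inter_filter[symmetric]) simp
  also have "{m\<in>{0..n}. odd m} = {m\<in>{1..n}. odd m}"
    by (auto simp: odd_pos Suc_le_eq)
  finally show ?thesis .
qed

lemma odd_overpartition_fps_deriv:
  "fps_X * fps_deriv odd_overpartition_fps = 2 * odd_divisor_sum_fps * odd_overpartition_fps"
proof (rule fps_ext)
  fix n
  have "(2 * odd_divisor_sum_fps * odd_overpartition_fps) $ n =
      2 * (odd_divisor_sum_fps * odd_overpartition_fps) $ n"
    by (simp only: mult_2 distrib_right fps_add_nth)
  then show "(fps_X * fps_deriv odd_overpartition_fps) $ n =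
      (2 * odd_divisor_sum_fps * odd_overpartition_fps) $ n"
    using arg_cong[OF card_odd_overpartitions_rec[of n], of int]
    by (simp only: fps_X_mult_deriv_nth odd_divisor_sum_fps_mult_nth odd_overpartition_fps_nth
      of_nat_mult of_nat_sum of_nat_numeral)
qed

text \<open>Raising to the power \<open>k\<close> multiplies the logarithmic derivative by
  \<open>k\<close>. The case \<open>k = 0\<close> is separate because the power rule lowers the
  exponent.\<close>

lemma OPT_rec:
  "n * OPT k n = 2 * k * (\<Sum>m\<in>{m\<in>{1..n}. odd m}. divisor_sum m * OPT k (n - m))"
proof (cases k)
  case 0
  then show ?thesis by (simp add: OPT_0)
next
  case (Suc j)
  let ?A = odd_overpartition_fps
  have "fps_X * fps_deriv (?A ^ k) = of_nat k * (fps_X * fps_deriv ?A) * ?A ^ j"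
    by (simp only: fps_deriv_power fps_of_nat Suc diff_Suc_1 mult_ac)
  also have "\<dots> = of_nat (2 * k) * (odd_divisor_sum_fps * ?A ^ k)"
    by (simp only: odd_overpartition_fps_deriv Suc power_Suc of_nat_mult of_nat_numeral mult_ac)
  finally have "int n * (?A ^ k) $ n = int (2 * k) * (odd_divisor_sum_fps * ?A ^ k) $ n"
    by (metis fps_X_mult_deriv_nth fps_mult_of_nat_nth(1))
  then have "int (n * OPT k n) =
      int (2 * k * (\<Sum>m\<in>{m\<in>{1..n}. odd m}. divisor_sum m * OPT k (n - m)))"
    by (simp add: odd_divisor_sum_fps_mult_nth flip: OPT_eq_fps_nth)
  then show ?thesis by (simp only: of_nat_eq_iff)
qed

section \<open>Divisibility by powers of 3\<close>

lemma three_dvd_divisor_sum: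
  assumes "m mod 3 = 2"
  shows "3 dvd divisor_sum m"
proof -
  have m: "m > 0" using assms by (cases m) auto
  let ?D = "{d. d dvd m}"
  have "bij_betw (\<lambda>d. m div d) ?D ?D"
    using m by (intro bij_betw_byWitness[where f' = "\<lambda>d. m div d"]) auto
  then have "(\<Sum>d\<in>?D. m div d) = divisor_sum m"
    unfolding divisor_sum_def by (rule sum.reindex_bij_betw)
  \<comment> \<open>Doubling pairs each \<open>d\<close> with its codivisor without choosing
    representatives; 2 is invertible modulo 3.\<close>
  then have "2 * divisor_sum m = (\<Sum>d\<in>?D. d + m div d)"
    by (simp add: sum.distrib divisor_sum_def)
  also have "3 dvd \<dots>"
  proof (rule dvd_sum)
    fix d assume "d \<in> ?D"
    then obtain e where e: "m = d * e" by auto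
    have "d mod 3 < 3" "e mod 3 < 3" by simp_all
    moreover have "(d mod 3) * (e mod 3) mod 3 = 2"
      using assms e by (simp add: mod_mult_eq)
    \<comment> \<open>Of the nine residue pairs only (1, 2) and (2, 1) have product 2.\<close>
    ultimately have "(d mod 3 + e mod 3) mod 3 = 0"
      unfolding numeral_3_eq_3 less_Suc_eq by auto
    then have "3 dvd d + e" by (simp add: mod_add_eq dvd_eq_mod_eq_0)
    then show "3 dvd d + m div d" using m e by simp
  qed
  finally show ?thesis by presburger
qed

lemma coprime_three_nat: "\<not> 3 dvd n \<Longrightarrow> coprime (3 :: nat) n"
  by (rule prime_imp_coprime) simp_all

lemma three_dvd_OPT:
  assumes "3 dvd k" "\<not> 3 dvd n"
  shows "3 dvd OPT k n"
proof -
  have "3 dvd n * OPT k n" unfolding OPT_rec using assms(1) by simp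
  then show ?thesis
    using coprime_three_nat[OF assms(2)] by (simp add: coprime_dvd_mult_right_iff)
qed

theorem theorem1p6:
  fixes i n :: nat
  assumes "i \<ge> 1"
  shows "[OPT (3 ^ i) (3 * n + 2) = 0] (mod 3 ^ (i + 1))"
proof -
  let ?N = "3 * n + 2" and ?k = "3 ^ i :: nat"
  have "3 dvd ?k" using assms by simp
  have "3 dvd (\<Sum>m\<in>{m\<in>{1..?N}. odd m}. divisor_sum m * OPT ?k (?N - m))"
  proof (rule dvd_sum)
    fix m assume "m \<in> {m\<in>{1..?N}. odd m}"
    then have "m \<le> ?N" by simp
    \<comment> \<open>If 3 divides \<open>?N - m\<close>, then \<open>m\<close> is congruent to
      \<open>?N\<close>, hence to 2.\<close>
    then have "m mod 3 = 2 \<or> \<not> 3 dvd ?N - m" by presburger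
    then show "3 dvd divisor_sum m * OPT ?k (?N - m)"
      using three_dvd_divisor_sum three_dvd_OPT[OF \<open>3 dvd ?k\<close>] by (metis dvd_mult dvd_mult2)
  qed
  \<comment> \<open>The factor \<open>k\<close> of the recurrence supplies \<open>3 ^ i\<close>, the
    sum one more 3.\<close>
  then have "?k * 3 dvd ?N * OPT ?k ?N"
    unfolding OPT_rec[of ?N] by (simp add: mult.assoc mult_dvd_mono)
  moreover have "\<not> 3 dvd ?N" by presburger
  then have "coprime (3 ^ (i + 1)) ?N"
    by (metis coprime_three_nat coprime_power_left_iff)
  ultimately have "3 ^ (i + 1) dvd OPT ?k ?N"
    by (metis coprime_dvd_mult_right_iff power_add power_one_right)
  then show ?thesis by (simp only: cong_0_iff)
qed

end
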